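(* Let $p$ be a prime number, $\chi_1$ the principal Dirichlet character modulo $p$, and $\alpha,\beta>0$ with $\alpha\beta=\pi^2/p^2$. Define $a_n=1$ if $\gcd(n,p)=1$ and $a_n=1-p$ if $p\mid n$. Then \[ \sum_{n=1}^{\infty}a_n\Big(\sum_{d\mid n}\frac{\chi_1(d)}{d}\Big)e^{-2n\alpha}-\sum_{n=1}^{\infty}a_n\Big(\sum_{d\mid n}\frac{\chi_1(d)}{d}\Big)e^{-2n\beta}=\frac{(p-1)^2}{2p}\log\left(\frac{\pi}{p\alpha}\right). \] *)

theory Defs
  imports Complex_Main "HOL-Computational_Algebra.Primes"
begin

definition principal_dchar :: "nat \<Rightarrow> nat \<Rightarrow> complex" where
  "principal_dchar m n = (if coprime n m then 1 else 0)"

definition twist_coeff :: "nat \<Rightarrow> nat \<Rightarrow> complex" where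
  "twist_coeff p n = (if p dvd n then 1 - of_nat p else 1)"

(* only meaningful for n >= 1: at n = 0 the index set of the divisor sum is infinite *)
definition lambert_term :: "nat \<Rightarrow> real \<Rightarrow> nat \<Rightarrow> complex" where
  "lambert_term p x n =
     twist_coeff p n * (\<Sum>d | d dvd n. principal_dchar p d / of_nat d)
       * of_real (exp (- 2 * real n * x))"

end

(* Expanding 1 / (e^(2 pi d u) - 1) in partial fractions turns
   S(u) = sum_d 1 / (d (e^(2 pi d u) - 1)) into a conditionally convergent lattice sum of
   h(d, k) = u / (d^2 u^2 + k^2), and u -> 1/u only exchanges the roles of d and k.  Truncate
   at d <= N for S(u) and at k <= M for S(1/u) with M ~ u N.  The common box d <= N, k <= M
   cancels, and the two remaining corners are Riemann sums of the same integral of arctan s / s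
   over [0,1] and cancel in the limit.  The difference of the harmonic numbers of N and M
   produces the logarithm; this is the transformation law of log eta.  The twisted series at x
   is S(u) - (p + 1/p) S(p u) + S(p^2 u) with u = x / pi; in this combination the terms
   pi/(12 u) and pi u/12 of the transformation law cancel. *)

theory Submission
  imports Defs "HOL-Analysis.Analysis"
begin

section \<open>Absolutely convergent double series and their regrouping by divisors\<close>

section \<open>Lambert series of the divisor sum\<close>

text \<open>The guard keeps the index set finite for every n and empty at n = 0, so series can run
  over all naturals.\<close>

definition sigma_inv :: "nat \<Rightarrow> real" where
  "sigma_inv n = (\<Sum>d | 0 < n \<and> d dvd n. 1 / real d)"

text \<open>All terms are nonnegative, so it is enough to sum row by row: each row in k is
  geometric, and the row sums are dominated by a geometric series.\<close>

lemma has_sum_lambert: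
  fixes x :: real
  assumes x: "x > 0"
  shows "((\<lambda>(d, k). 1 / real d * exp (- (real d * real k * x))) has_sum
     (\<Sum>d. 1 / (real (Suc d) * (exp (real (Suc d) * x) - 1)))) ({1..} \<times> {1..})"
    and "summable (\<lambda>d. 1 / (real (Suc d) * (exp (real (Suc d) * x) - 1)))"
proof -
  define f where "f = (\<lambda>(d, k). 1 / real d * exp (- (real d * real k * x)))"
  define g where "g = (\<lambda>d. 1 / (real d * (exp (real d * x) - 1)))"
  have inner: "((\<lambda>k. f (d, k)) has_sum g d) {1..}" if d: "d \<in> {1..}" for d
  proof -
    define r where "r = exp (- (real d * x))"
    have r: "0 < r" "r < 1" using d x by (auto simp: r_def)
    have "(\<lambda>k. 1 / real d * r * r ^ k) sums (1 / real d * r * (1 / (1 - r)))"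
      by (intro sums_mult geometric_sums) (use r in auto)
    then have "((\<lambda>k. 1 / real d * r * r ^ k) has_sum (1 / real d * r * (1 / (1 - r)))) UNIV"
      by (rule sums_nonneg_imp_has_sum) (use r in auto)
    also have "1 / real d * r * (1 / (1 - r)) = g d"
      using r d by (simp add: g_def r_def exp_minus field_simps)
    also have "((\<lambda>k. 1 / real d * r * r ^ k) has_sum g d) UNIV \<longleftrightarrow> ((\<lambda>k. f (d, k)) has_sum g d) {1..}"
      by (rule has_sum_reindex_bij_witness[of _ "\<lambda>k. k - 1" Suc])
        (auto simp: f_def r_def exp_of_nat_mult[symmetric] exp_add[symmetric] algebra_simps)
    finally show ?thesis .
  qed
  have s: "summable (\<lambda>d. g (Suc d))"
  proof (rule summable_comparison_test')
    define r where "r = exp (- x)"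
    have r: "0 < r" "r < 1" using x by (auto simp: r_def)
    \<comment> \<open>For m >= 1 the row sum is \<open>r ^ m / (m * (1 - r ^ m))\<close>, and 1 -
      r^m >= 1 - r.\<close>
    show "summable (\<lambda>d. 1 / (1 - r) * r ^ Suc d)"
      by (intro summable_mult summable_geometric[THEN summable_Suc_iff[THEN iffD2]]) (use r in auto)
    fix d :: nat
    define m where "m = Suc d"
    have "r ^ m = exp (- (real m * x))" by (simp add: r_def exp_of_nat_mult[symmetric])
    then have E: "exp (real m * x) = 1 / r ^ m" by (simp add: exp_minus inverse_eq_divide)
    have rm: "0 < r ^ m" "r ^ m \<le> r" using r power_decreasing[of 1 m r] by (auto simp: m_def)
    have rm1: "r ^ m < 1" using rm r by linarith
    have m0: "real m > 0" by (simp add: m_def)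
    have g0: "0 \<le> g m" using x by (simp add: g_def)
    have "g m = 1 / real m * (r ^ m / (1 - r ^ m))"
    proof -
      have "1 / (c * (1 / s - 1)) = 1 / c * (s / (1 - s))" if "0 < s" "s < 1" "c > 0" for c s :: real
        using that by (simp add: field_simps)
      then show ?thesis unfolding g_def E using rm(1) rm1 m0 by blast
    qed
    also have "\<dots> \<le> 1 * (r ^ m / (1 - r))"
      by (intro mult_mono frac_le) (use rm rm1 m0 r in \<open>auto simp: m_def simp del: power_Suc\<close>)
    finally show "norm (g (Suc d)) \<le> 1 / (1 - r) * r ^ Suc d"
      using g0 by (simp add: m_def)
  qed
  then show "summable (\<lambda>d. 1 / (real (Suc d) * (exp (real (Suc d) * x) - 1)))" by (simp only: g_def)
  have "((\<lambda>d. g (Suc d)) has_sum (\<Sum>d. g (Suc d))) UNIV"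
    by (rule sums_nonneg_imp_has_sum[OF summable_sums[OF s]]) (use x in \<open>simp add: g_def\<close>)
  also have "?this \<longleftrightarrow> (g has_sum (\<Sum>d. g (Suc d))) {1..}"
    by (rule has_sum_reindex_bij_witness[of _ "\<lambda>k. k - 1" Suc]) auto
  finally have outer: "(g has_sum (\<Sum>d. g (Suc d))) {1..}" .
  have "f summable_on ({1..} \<times> {1..})"
    by (rule summable_on_SigmaI[OF inner]) (use outer in \<open>auto simp: f_def summable_on_def\<close>)
  then have "(f has_sum (\<Sum>d. g (Suc d))) ({1..} \<times> {1..})"
    by (intro has_sum_SigmaI[OF inner outer])
  then show "((\<lambda>(d, k). 1 / real d * exp (- (real d * real k * x))) has_sum
     (\<Sum>d. 1 / (real (Suc d) * (exp (real (Suc d) * x) - 1)))) ({1..} \<times> {1..})"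
    by (simp only: f_def g_def)
qed

text \<open>Collecting the pairs (d, k) with the same product n = d k leaves a sum over the divisors
  d of n.\<close>

lemma sigma_inv_sums:
  fixes x :: real
  assumes x: "x > 0"
  shows "(\<lambda>n. sigma_inv n * exp (- (real n * x))) sums (\<Sum>d. 1 / (real (Suc d) * (exp (real (Suc d) * x) - 1)))"
    (is "_ sums ?S")
proof -
  define D where "D = (\<lambda>n::nat. {d. 0 < n \<and> d dvd n})"
  have fin: "finite (D n)" for n
    by (rule finite_subset[of _ "{..n}"]) (auto simp: D_def intro: dvd_imp_le)
  have "((\<lambda>(d, k). 1 / real d * exp (- (real d * real k * x))) has_sum ?S) ({1..} \<times> {1..}) \<longleftrightarrow>
     ((\<lambda>(n, d). 1 / real d * exp (- (real n * x))) has_sum ?S) (Sigma UNIV D)"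
    by (rule has_sum_reindex_bij_witness[of _ "\<lambda>(n, d). (d, n div d)" "\<lambda>(d, k). (d * k, d)"])
      (auto simp: D_def Suc_le_eq dvd_pos_nat elim!: dvdE)
  then have "((\<lambda>(n, d). 1 / real d * exp (- (real n * x))) has_sum ?S) (Sigma UNIV D)"
    using has_sum_lambert(1)[OF x] by blast
  then have "((\<lambda>n. sigma_inv n * exp (- (real n * x))) has_sum ?S) UNIV"
    by (rule has_sum_SigmaD)
      (auto simp: sigma_inv_def sum_distrib_right D_def fin[unfolded D_def] intro!: has_sum_finiteI)
  then show ?thesis by (rule has_sum_imp_sums)
qed

text \<open>For u > 0 this is -ln of the product of 1 - exp(-2 pi n u) over n >= 1, that is -ln
  eta(i u) - pi u / 12 with the Dedekind eta function.\<close>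

definition eta_sum :: "real \<Rightarrow> real" where
  "eta_sum u = (\<Sum>d. 1 / (real (Suc d) * (exp (2 * pi * real (Suc d) * u) - 1)))"

lemma eta_sum_sums:
  fixes x :: real
  assumes "x > 0"
  shows "(\<lambda>n. sigma_inv n * exp (- 2 * real n * x)) sums eta_sum (x / pi)"
proof -
  have "2 * x > 0" using assms by simp
  from sigma_inv_sums[OF this] show ?thesis
    by (simp add: eta_sum_def mult_ac del: of_nat_Suc)
qed

lemma eta_sum_summable:
  fixes u :: real
  assumes "u > 0"
  shows "summable (\<lambda>d. 1 / (real (Suc d) * (exp (2 * pi * real (Suc d) * u) - 1)))"
proof -
  have "2 * pi * u > 0" using assms by simp
  from has_sum_lambert(2)[OF this] show ?thesis by (simp add: mult_ac del: of_nat_Suc)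
qed


section \<open>From the sine product to the expansion of coth\<close>

section \<open>Partial fractions of coth\<close>

text \<open>This is Euler's product for the sine at the imaginary point i x; the common factor i is
  cancelled at the end.\<close>

lemma sinh_product_formula:
  fixes x :: real
  shows "(\<lambda>n. pi * x * (\<Prod>k=1..n. 1 + x\<^sup>2 / (real k)\<^sup>2)) \<longlonglongrightarrow> sinh (pi * x)"
proof -
  have "(\<lambda>n. of_real pi * (\<i> * of_real x) * (\<Prod>k=1..n. 1 - (\<i> * of_real x)^2 / of_nat k^2))
          \<longlonglongrightarrow> sin (of_real pi * (\<i> * of_real x))"
    by (rule sin_product_formula_complex)
  also have "sin (of_real pi * (\<i> * of_real x)) = \<i> * of_real (sinh (pi * x))"
    by (simp add: sinh_def sin_exp_eq exp_of_real[symmetric] scaleR_conv_of_real field_simps)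
  also have "(\<lambda>n. of_real pi * (\<i> * of_real x) * (\<Prod>k=1..n. 1 - (\<i> * of_real x)^2 / of_nat k^2))
       = (\<lambda>n. \<i> * of_real (pi * x * (\<Prod>k=1..n. 1 + x\<^sup>2 / (real k)\<^sup>2)))"
    by (simp add: power_mult_distrib mult_ac)
  finally show ?thesis
    by (subst (asm) tendsto_mult_left_iff) (simp_all del: of_real_mult add: tendsto_of_real_iff)
qed

lemma sums_ln_sinh_product:
  fixes x :: real
  assumes "x > 0"
  shows "(\<lambda>k. ln (1 + x\<^sup>2 / (real (Suc k))\<^sup>2)) sums ln (sinh (pi * x) / (pi * x))"
proof -
  have pos: "1 + x\<^sup>2 / (real k)\<^sup>2 > 0" for k by (simp add: add_pos_nonneg)
  have "(\<lambda>n. pi * x * (\<Prod>k=1..n. 1 + x\<^sup>2 / (real k)\<^sup>2) / (pi * x)) \<longlonglongrightarrow> sinh (pi * x) / (pi * x)"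
    by (intro tendsto_divide sinh_product_formula tendsto_const) (use assms in auto)
  then have "(\<lambda>n. \<Prod>k=1..n. 1 + x\<^sup>2 / (real k)\<^sup>2) \<longlonglongrightarrow> sinh (pi * x) / (pi * x)"
    using assms by simp
  then have "(\<lambda>n. ln (\<Prod>k=1..n. 1 + x\<^sup>2 / (real k)\<^sup>2)) \<longlonglongrightarrow> ln (sinh (pi * x) / (pi * x))"
    by (intro tendsto_ln) (use assms in auto)
  also have "(\<lambda>n. ln (\<Prod>k=1..n. 1 + x\<^sup>2 / (real k)\<^sup>2)) = (\<lambda>n. \<Sum>k=1..n. ln (1 + x\<^sup>2 / (real k)\<^sup>2))"
    by (intro ext ln_prod) (use pos in \<open>auto simp: less_imp_neq[symmetric]\<close>)
  also have "\<dots> = (\<lambda>n. \<Sum>k<n. ln (1 + x\<^sup>2 / (real (Suc k))\<^sup>2))"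
    by (intro ext sum.reindex_bij_witness[of _ Suc "\<lambda>k. k - 1"]) auto
  finally show ?thesis unfolding sums_def .
qed

text \<open>Termwise differentiation of the series for ln (sinh (pi x) / (pi x)). The limit is half
  of pi coth(pi x) - 1/x, written so that the Lambert summand appears.\<close>

lemma coth_partial_fractions:
  fixes x :: real
  assumes "x > 0"
  shows "(\<lambda>k. x / (x\<^sup>2 + (real (Suc k))\<^sup>2)) sums (pi / (exp (2 * pi * x) - 1) - 1 / (2 * x) + pi / 2)"
proof -
  \<comment> \<open>A bound on t is needed to dominate the derivatives uniformly by
    \<open>2 * R / (real (Suc k))^2\<close> in the Weierstrass test; any number above
    \<open>x\<close> would do.\<close>
  define R where "R = x + 1"
  define f where "f = (\<lambda>k t. ln (1 + t\<^sup>2 / (real (Suc k))\<^sup>2))"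
  define f' where "f' = (\<lambda>k t. 2 * t / (t\<^sup>2 + (real (Suc k))\<^sup>2))"
  have der: "(f k has_field_derivative f' k t) (at t within {0<..<R})" if "t \<in> {0<..<R}" for k t
  proof -
    have "1 + t\<^sup>2 / (real (Suc k))\<^sup>2 > 0" by (simp add: add_pos_nonneg)
    moreover have "t\<^sup>2 + (real (Suc k))\<^sup>2 > 0" by (simp add: add_nonneg_pos del: of_nat_Suc)
    ultimately show ?thesis unfolding f_def f'_def
      by (auto intro!: derivative_eq_intros simp: divide_simps simp del: of_nat_Suc)
  qed
  have summ: "summable (\<lambda>k. 2 * R / (real (Suc k))\<^sup>2)"
    using summable_mult[OF sums_summable[OF inverse_squares_sums], of "2 * R"] by (simp add: add.commute)
  have bnd: "norm (f' k t) \<le> 2 * R / (real (Suc k))\<^sup>2" if "t \<in> {0<..<R}" for k t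
    unfolding f'_def using that by (auto intro!: frac_le simp del: of_nat_Suc)
  have unif: "uniformly_convergent_on {0<..<R} (\<lambda>n t. \<Sum>k<n. f' k t)"
    by (rule Weierstrass_m_test'[OF bnd summ])
  have xin: "x \<in> {0<..<R}" using assms by (auto simp: R_def)
  have s0: "summable (\<lambda>k. f k x)"
    using sums_ln_sinh_product[OF assms] by (auto simp: f_def sums_iff)
  have D: "((\<lambda>t. \<Sum>k. f k t) has_field_derivative (\<Sum>k. f' k x)) (at x)"
    by (rule has_field_derivative_series'(2)[OF _ der unif xin s0]) (use xin in auto)
  have "((\<lambda>t. ln (sinh (pi * t) / (pi * t))) has_field_derivative (\<Sum>k. f' k x)) (at x)"
    by (rule has_field_derivative_transform_within_open[OF D, of "{0<..}"])
      (use assms sums_ln_sinh_product in \<open>auto simp: f_def sums_iff\<close>)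
  moreover have "((\<lambda>t. ln (sinh (pi * t) / (pi * t))) has_field_derivative
       (pi * cosh (pi * x) / sinh (pi * x) - 1 / x)) (at x)"
    using assms by (auto intro!: derivative_eq_intros simp: field_simps power2_eq_square)
  ultimately have eq: "(\<Sum>k. f' k x) = pi * cosh (pi * x) / sinh (pi * x) - 1 / x"
    by (rule DERIV_unique)
  have "summable (\<lambda>k. f' k x)"
    by (rule summable_comparison_test'[OF summ]) (use bnd xin in auto)
  then have "(\<lambda>k. f' k x) sums (pi * cosh (pi * x) / sinh (pi * x) - 1 / x)"
    using eq by (simp add: sums_iff)
  then have "(\<lambda>k. f' k x / 2) sums ((pi * cosh (pi * x) / sinh (pi * x) - 1 / x) / 2)"
    by (rule sums_divide)
  moreover have "(pi * cosh (pi * x) / sinh (pi * x) - 1 / x) / 2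
      = pi / (exp (2 * pi * x) - 1) - 1 / (2 * x) + pi / 2"
  proof -
    \<comment> \<open>With E^2 = exp(2 pi x), coth(pi x) = (E^2 + 1) / (E^2 - 1) = 1 + 2 / (E^2 -
      1).\<close>
    define E where "E = exp (pi * x)"
    have E: "E > 1" using assms by (simp add: E_def)
    have e2: "exp (2 * pi * x) = E\<^sup>2" by (simp add: E_def exp_double[symmetric] mult.assoc)
    have E2: "E\<^sup>2 - 1 > 0" using E by (simp add: one_less_power)
    have "cosh (pi * x) = (E + inverse E) / 2" "sinh (pi * x) = (E - inverse E) / 2"
      by (simp_all add: cosh_field_def sinh_field_def E_def exp_minus)
    moreover have "(a / 2) / (b / 2) = a / b" for a b :: real by simp
    ultimately have "cosh (pi * x) / sinh (pi * x) = (E + inverse E) / (E - inverse E)"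
      by (simp only:)
    also have "\<dots> = (E\<^sup>2 + 1) / (E\<^sup>2 - 1)" using E E2 by (simp add: field_simps power2_eq_square)
    also have "\<dots> = 1 + 2 / (E\<^sup>2 - 1)" using E2 by (simp add: field_simps)
    finally have "pi * (cosh (pi * x) / sinh (pi * x)) = pi * (1 + 2 / (E\<^sup>2 - 1))" by simp
    moreover have "(pi * (1 + 2 / Q) - 1 / x) / 2 = pi / Q - 1 / (2 * x) + pi / 2" for Q
      by (simp add: algebra_simps add_divide_distrib diff_divide_distrib)
    ultimately show ?thesis unfolding e2 by (simp only: times_divide_eq_right[symmetric])
  qed
  moreover have "2 * x / w / 2 = x / w" for w by simp
  ultimately show ?thesis by (simp only: f'_def)
qed

section \<open>Riemann sums, the function arctan s / s, and tails of the lattice rows\<close>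

section \<open>Corners of the lattice sum\<close>

text \<open>Monotonicity traps each term between integrals over neighbouring steps, and these
  telescope. The interval reaches to 2 because the last sample points only tend to 1 and may lie
  beyond it.\<close>

lemma riemann_sum_decreasing_tendsto:
  fixes \<phi> :: "real \<Rightarrow> real" and z :: "nat \<Rightarrow> real" and N :: "nat \<Rightarrow> nat"
  assumes cont: "continuous_on {0..2} \<phi>" and anti: "antimono_on {0..2} \<phi>"
    and zpos: "\<And>n. z n > 0" and z0: "z \<longlonglongrightarrow> 0" and Nz: "(\<lambda>n. N n * z n) \<longlonglongrightarrow> 1"
  shows "(\<lambda>n. \<Sum>d=1..N n. z n * \<phi> (d * z n)) \<longlonglongrightarrow> integral {0..1} \<phi>"
proof -
  define \<Phi> where "\<Phi> = (\<lambda>x. integral {0..x} \<phi>)"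
  have int: "\<phi> integrable_on {a..b}" if "0 \<le> a" "b \<le> 2" for a b
    by (rule integrable_continuous_real) (use that in \<open>auto intro: continuous_on_subset[OF cont]\<close>)
  have \<Phi>cont: "continuous_on {0..2} \<Phi>"
    unfolding \<Phi>_def by (rule indefinite_integral_continuous_1) (rule int, auto)
  have diff: "\<Phi> b - \<Phi> a = integral {a..b} \<phi>" if "0 \<le> a" "a \<le> b" "b \<le> 2" for a b
    using Henstock_Kurzweil_Integration.integral_combine[of 0 a b \<phi>] int[of 0 b] that by (simp add: \<Phi>_def)
  have upper: "\<Phi> b - \<Phi> a \<le> (b - a) * \<phi> a" if "0 \<le> a" "a \<le> b" "b \<le> 2" for a b
  proof -
    have "integral {a..b} \<phi> \<le> integral {a..b} (\<lambda>_. \<phi> a)"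
      by (rule integral_le) (use that int anti in \<open>auto simp: monotone_on_def\<close>)
    with diff[OF that] that show ?thesis by simp
  qed
  have lower: "(b - a) * \<phi> b \<le> \<Phi> b - \<Phi> a" if "0 \<le> a" "a \<le> b" "b \<le> 2" for a b
  proof -
    have "integral {a..b} (\<lambda>_. \<phi> b) \<le> integral {a..b} \<phi>"
      by (rule integral_le) (use that int anti in \<open>auto simp: monotone_on_def\<close>)
    with diff[OF that] that show ?thesis by simp
  qed
  have N1z: "(\<lambda>n. Suc (N n) * z n) \<longlonglongrightarrow> 1"
    using tendsto_add[OF Nz z0] by (simp add: algebra_simps)
  have ev: "\<forall>\<^sub>F n in sequentially. Suc (N n) * z n < 2"
    by (rule order_tendstoD[OF N1z]) auto
  have zmono: "real d * z n \<le> real e * z n" if "d \<le> e" for d e n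
    using that zpos[of n] by simp
  \<comment> \<open>Each term is at most the integral over the step to the left of its sample
    point.\<close>
  have up: "\<forall>\<^sub>F n in sequentially. (\<Sum>d=1..N n. z n * \<phi> (d * z n)) \<le> \<Phi> (N n * z n) - \<Phi> 0"
    using ev
  proof eventually_elim
    case (elim n)
    have "(\<Sum>d=1..N n. z n * \<phi> (d * z n)) = (\<Sum>d<N n. z n * \<phi> (Suc d * z n))"
      by (intro sum.reindex_bij_witness[of _ Suc "\<lambda>d. d - 1"]) auto
    also have "\<dots> \<le> (\<Sum>d<N n. \<Phi> (Suc d * z n) - \<Phi> (d * z n))"
    proof (rule sum_mono)
      fix d assume "d \<in> {..<N n}"
      then have "real (Suc d) * z n \<le> 2"
        using elim zmono[of "Suc d" "Suc (N n)" n] by simp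
      then show "z n * \<phi> (Suc d * z n) \<le> \<Phi> (Suc d * z n) - \<Phi> (d * z n)"
        using lower[of "d * z n" "Suc d * z n"] zpos[of n] by (simp add: algebra_simps)
    qed
    also have "\<dots> = \<Phi> (N n * z n) - \<Phi> 0"
      by (subst sum_lessThan_telescope) simp
    finally show ?case .
  qed
  \<comment> \<open>Each term is at least the integral over the step to the right, so the integrals
    start at \<open>z n\<close> and reach one step beyond \<open>N n * z n\<close>.\<close>
  have lo: "\<forall>\<^sub>F n in sequentially. \<Phi> (Suc (N n) * z n) - \<Phi> (z n) \<le> (\<Sum>d=1..N n. z n * \<phi> (d * z n))"
    using ev
  proof eventually_elim
    case (elim n)
    have "\<Phi> (Suc (N n) * z n) - \<Phi> (z n) = (\<Sum>d<N n. \<Phi> (Suc (Suc d) * z n) - \<Phi> (Suc d * z n))"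
      by (subst sum_lessThan_telescope) simp
    also have "\<dots> \<le> (\<Sum>d<N n. z n * \<phi> (Suc d * z n))"
    proof (rule sum_mono)
      fix d assume "d \<in> {..<N n}"
      then have "real (Suc (Suc d)) * z n \<le> 2"
        using elim zmono[of "Suc (Suc d)" "Suc (N n)" n] by simp
      then show "\<Phi> (Suc (Suc d) * z n) - \<Phi> (Suc d * z n) \<le> z n * \<phi> (Suc d * z n)"
        using upper[of "Suc d * z n" "Suc (Suc d) * z n"] zpos[of n] by (simp add: algebra_simps)
    qed
    also have "\<dots> = (\<Sum>d=1..N n. z n * \<phi> (d * z n))"
      by (intro sum.reindex_bij_witness[of _ "\<lambda>d. d - 1" Suc]) auto
    finally show ?case .
  qed
  have in02: "\<forall>\<^sub>F n in sequentially. N n * z n \<in> {0..2}" "\<forall>\<^sub>F n in sequentially. Suc (N n) * z n \<in> {0..2}"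
    "\<forall>\<^sub>F n in sequentially. z n \<in> {0..2}"
  proof -
    have "N n * z n \<in> {0..2} \<and> Suc (N n) * z n \<in> {0..2} \<and> z n \<in> {0..2}" if "Suc (N n) * z n < 2" for n
    proof -
      have "N n * z n \<le> Suc (N n) * z n" "z n \<le> Suc (N n) * z n"
        using zmono[of "N n" "Suc (N n)" n] zmono[of 1 "Suc (N n)" n] by simp_all
      moreover have "0 \<le> N n * z n" using zpos[of n] by simp
      ultimately show ?thesis using that zpos[of n] unfolding atLeastAtMost_iff by linarith
    qed
    with ev show "\<forall>\<^sub>F n in sequentially. N n * z n \<in> {0..2}" "\<forall>\<^sub>F n in sequentially. Suc (N n) * z n \<in> {0..2}"
      "\<forall>\<^sub>F n in sequentially. z n \<in> {0..2}"
      by (blast intro: eventually_mono)+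
  qed
  have \<Phi>01: "\<Phi> 0 = 0" "\<Phi> 1 = integral {0..1} \<phi>" by (simp_all add: \<Phi>_def)
  have "(\<lambda>n. \<Phi> (N n * z n) - \<Phi> 0) \<longlonglongrightarrow> \<Phi> 1 - \<Phi> 0"
    by (intro tendsto_diff tendsto_const continuous_on_tendsto_compose[OF \<Phi>cont Nz _ in02(1)]) auto
  moreover have "(\<lambda>n. \<Phi> (Suc (N n) * z n) - \<Phi> (z n)) \<longlonglongrightarrow> \<Phi> 1 - \<Phi> 0"
    by (intro tendsto_diff continuous_on_tendsto_compose[OF \<Phi>cont N1z _ in02(2)]
          continuous_on_tendsto_compose[OF \<Phi>cont z0 _ in02(3)]) auto
  ultimately show ?thesis
    using tendsto_sandwich[OF lo up] by (simp add: \<Phi>01)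
qed

text \<open>Division by 0 yields 0, so the limit 1 is put in by hand to make the function continuous
  at 0.\<close>

definition arctan_quot :: "real \<Rightarrow> real" where
  "arctan_quot s = (if s = 0 then 1 else arctan s / s)"

lemma continuous_on_arctan_quot: "continuous_on A arctan_quot"
proof -
  have "isCont arctan_quot s" for s
  proof (cases "s = 0")
    case False
    have "isCont (\<lambda>s. arctan s / s) s" using False by (auto intro!: continuous_intros)
    moreover have "\<forall>\<^sub>F t in nhds s. arctan_quot t = arctan t / t"
      using False by (intro eventually_mono[OF t1_space_nhds[of s 0]]) (auto simp: arctan_quot_def)
    ultimately show ?thesis by (simp add: isCont_cong)
  next
    case True
    have "(arctan has_real_derivative 1) (at 0)"
      by (auto intro!: derivative_eq_intros)
    then have "(\<lambda>h. arctan h / h) \<midarrow>0\<rightarrow> 1" by (simp add: DERIV_def)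
    then have "arctan_quot \<midarrow>0\<rightarrow> 1"
      by (rule Lim_transform_eventually) (auto simp: arctan_quot_def eventually_at_filter)
    then show ?thesis using True by (simp add: isCont_def arctan_quot_def)
  qed
  then show ?thesis by (simp add: continuous_at_imp_continuous_on)
qed

text \<open>Both bounds come from the mean value theorem, with the derivative 1 / (1 + t^2) lying
  between 1 / (1 + s^2) and 1. They serve the monotonicity of arctan s / s: the lower one for the
  sign of its derivative, the upper one for the comparison with the value at 0.\<close>

lemma arctan_bounds_pos:
  fixes s :: real assumes "s > 0" shows "s / (1 + s\<^sup>2) \<le> arctan s" "arctan s \<le> s"
proof -
  obtain \<xi> where \<xi>: "0 < \<xi>" "\<xi> < s" "arctan s - arctan 0 = (s - 0) * inverse (1 + \<xi>\<^sup>2)"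
    using MVT2[OF assms, of arctan "\<lambda>x. inverse (1 + x\<^sup>2)"] DERIV_arctan by blast
  have "inverse (1 + s\<^sup>2) \<le> inverse (1 + \<xi>\<^sup>2)"
    using \<xi> by (intro le_imp_inverse_le) (auto simp: add_pos_nonneg intro: power_mono)
  then have "s * inverse (1 + s\<^sup>2) \<le> s * inverse (1 + \<xi>\<^sup>2)" using assms by (intro mult_left_mono) auto
  with \<xi> show "s / (1 + s\<^sup>2) \<le> arctan s" by (simp add: field_simps)
  have "inverse (1 + \<xi>\<^sup>2) \<le> 1" by (simp add: inverse_le_1_iff)
  then have "s * inverse (1 + \<xi>\<^sup>2) \<le> s * 1" using assms by (intro mult_left_mono) auto
  with \<xi> show "arctan s \<le> s" by simp
qed

lemma antimono_on_arctan_quot: "antimono_on {0..} arctan_quot"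
proof (rule monotone_onI)
  fix a b :: real assume ab: "a \<in> {0..}" "b \<in> {0..}" "a \<le> b"
  show "arctan_quot a \<ge> arctan_quot b"
  proof (cases "a = 0")
    case True
    then show ?thesis using ab arctan_bounds_pos(2)[of b] by (auto simp: arctan_quot_def)
  next
    case False
    have "arctan b / b \<le> arctan a / a"
    proof (rule DERIV_nonpos_imp_nonincreasing[OF ab(3)])
      fix x assume x: "a \<le> x" "x \<le> b"
      then have x0: "x > 0" using ab False by auto
      have "((\<lambda>x. arctan x / x) has_real_derivative (x / (1 + x\<^sup>2) - arctan x) / x\<^sup>2) (at x)"
        using x0 by (auto intro!: derivative_eq_intros simp: field_simps power2_eq_square)
      moreover have "(x / (1 + x\<^sup>2) - arctan x) / x\<^sup>2 \<le> 0"
        using arctan_bounds_pos(1)[OF x0] by (simp add: divide_nonpos_nonneg)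
      ultimately show "\<exists>y. ((\<lambda>x. arctan x / x) has_real_derivative y) (at x) \<and> y \<le> 0" by blast
    qed
    then show ?thesis using ab False by (auto simp: arctan_quot_def)
  qed
qed

text \<open>For a > 0 this is the partial fraction term x / (x^2 + b^2) of coth at x = a u, divided
  by a.\<close>

definition lattice_kernel :: "real \<Rightarrow> real \<Rightarrow> real \<Rightarrow> real" where
  "lattice_kernel u a b = u / (a\<^sup>2 * u\<^sup>2 + b\<^sup>2)"

text \<open>Numerator and denominator are multiplied by u^2. This symmetry is the source of the
  inversion formula.\<close>

lemma lattice_kernel_swap: "u > 0 \<Longrightarrow> lattice_kernel (1 / u) b a = lattice_kernel u a b"
  by (cases "a = 0") (auto simp: lattice_kernel_def field_simps power2_eq_square)

text \<open>Integral test: the kernel decreases in its last argument, so the tail sum lies between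
  its integrals from M + 1 and from M to infinity.\<close>

lemma lattice_kernel_tail:
  fixes d M u :: real
  assumes "d > 0" "M > 0" "u > 0"
  shows "summable (\<lambda>k. lattice_kernel u d (M + 1 + real k))"
    and "arctan (d * (u / (M + 1))) / d \<le> (\<Sum>k. lattice_kernel u d (M + 1 + real k))"
    and "(\<Sum>k. lattice_kernel u d (M + 1 + real k)) \<le> arctan (d * (u / M)) / d"
proof -
  \<comment> \<open>An antiderivative of the kernel in t; written with u / t inside the arctangent
    it tends to 0 at infinity, so the telescoping sum from a is just \<open>- g a\<close>.\<close>
  define g where "g = (\<lambda>t. - arctan (d * (u / t)) / d)"
  have der: "(g has_real_derivative lattice_kernel u d t) (at t)" if "t > 0" for t
  proof -
    have p: "d\<^sup>2 * u\<^sup>2 + t\<^sup>2 > 0" using that by (simp add: add_nonneg_pos)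
    have "(g has_real_derivative (- (inverse (1 + (d * (u / t))\<^sup>2) * (d * (- u / t\<^sup>2))) / d)) (at t)"
      unfolding g_def using that assms by (auto intro!: derivative_eq_intros simp: power2_eq_square)
    moreover have "inverse (1 + (d * (u / t))\<^sup>2) = t\<^sup>2 / (d\<^sup>2 * u\<^sup>2 + t\<^sup>2)"
      using that p by (simp add: field_simps power_mult_distrib power_divide)
    moreover have "- (t\<^sup>2 / (d\<^sup>2 * u\<^sup>2 + t\<^sup>2) * (d * (- u / t\<^sup>2))) / d = lattice_kernel u d t"
      using that assms by (simp add: lattice_kernel_def)
    ultimately show ?thesis by (simp only:)
  qed
  have step: "lattice_kernel u d (t + 1) \<le> g (t + 1) - g t \<and> g (t + 1) - g t \<le> lattice_kernel u d t" if t: "t > 0" for t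
  proof -
    obtain \<xi> where \<xi>: "t < \<xi>" "\<xi> < t + 1" "g (t + 1) - g t = (t + 1 - t) * lattice_kernel u d \<xi>"
      using MVT2[of t "t + 1" g "lattice_kernel u d"] der t by force
    have "lattice_kernel u d (t + 1) \<le> lattice_kernel u d \<xi>" "lattice_kernel u d \<xi> \<le> lattice_kernel u d t"
      unfolding lattice_kernel_def using \<xi> t assms
      by (auto intro!: divide_left_mono mult_pos_pos add_nonneg_pos power_mono add_left_mono)
    with \<xi> show ?thesis by simp
  qed
  have "(\<lambda>k. g (a + real k)) \<longlonglongrightarrow> - arctan (d * 0) / d" if "a > 0" for a
  proof -
    have "(\<lambda>k. u / (a + real k)) \<longlonglongrightarrow> 0"
      by (intro tendsto_divide_0[OF tendsto_const] filterlim_at_top_imp_at_infinity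
             filterlim_tendsto_add_at_top[OF tendsto_const] filterlim_real_sequentially)
    then show ?thesis unfolding g_def by (intro tendsto_intros) (use assms in auto)
  qed
  then have "(\<lambda>k. g (a + real (Suc k)) - g (a + real k)) sums (0 - g (a + real 0))" if "a > 0" for a
    using that by (intro telescope_sums) auto
  note telescope = this
  have tele: "(\<lambda>k. g (a + real k + 1) - g (a + real k)) sums (- g a)" if "a > 0" for a
    using telescope[OF that] by (simp add: add_ac)
  have t1: "lattice_kernel u d (M + 1 + real k) \<le> g (M + real k + 1) - g (M + real k)" for k
    using step[of "M + real k"] assms by (auto simp: add_ac)
  have t2: "g (M + 1 + real k + 1) - g (M + 1 + real k) \<le> lattice_kernel u d (M + 1 + real k)" for k
    using step[of "M + 1 + real k"] assms by auto
  show S: "summable (\<lambda>k. lattice_kernel u d (M + 1 + real k))"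
    by (rule summable_comparison_test'[OF sums_summable[OF tele[OF assms(2)]]])
      (use t1 assms in \<open>auto simp: lattice_kernel_def\<close>)
  have "- g (M + 1) \<le> (\<Sum>k. lattice_kernel u d (M + 1 + real k))"
    by (rule sums_le[OF t2 tele summable_sums[OF S]]) (use assms in auto)
  then show "arctan (d * (u / (M + 1))) / d \<le> (\<Sum>k. lattice_kernel u d (M + 1 + real k))"
    by (simp add: g_def)
  have "(\<Sum>k. lattice_kernel u d (M + 1 + real k)) \<le> - g M"
    by (rule sums_le[OF t1 summable_sums[OF S] tele]) (use assms in auto)
  then show "(\<Sum>k. lattice_kernel u d (M + 1 + real k)) \<le> arctan (d * (u / M)) / d"
    by (simp add: g_def)
qed

text \<open>The two arctangent bounds for the tails are Riemann sums for arctan s / s with mesh u /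
  M and u / (M + 1). The limit does not depend on u, which is why opposite corners cancel.\<close>

lemma lattice_corner_tendsto:
  fixes u :: real and M N :: "nat \<Rightarrow> nat"
  assumes u: "u > 0" and M: "\<And>n. M n > 0" "filterlim M at_top sequentially"
    and ratio: "(\<lambda>n. real (N n) * (u / real (M n))) \<longlonglongrightarrow> 1"
  shows "(\<lambda>n. \<Sum>d=1..N n. \<Sum>k. lattice_kernel u (real d) (real (M n) + 1 + real k)) \<longlonglongrightarrow> integral {0..1} arctan_quot"
proof -
  have cont: "continuous_on {0..2} arctan_quot" by (rule continuous_on_arctan_quot)
  have anti: "antimono_on {0..2} arctan_quot"
    by (rule monotone_on_subset[OF antimono_on_arctan_quot]) auto
  have riem: "(\<Sum>d=1..N n. z * arctan_quot (real d * z)) = (\<Sum>d=1..N n. arctan (real d * z) / real d)" if "z > 0" for z :: real and n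
    by (rule sum.cong) (use that in \<open>auto simp: arctan_quot_def\<close>)
  have M1pos: "0 < real (M n) + 1" for n by simp
  have M': "filterlim (\<lambda>n. real (M n)) at_top sequentially"
    by (rule filterlim_compose[OF filterlim_real_sequentially M(2)])
  then have M1': "filterlim (\<lambda>n. real (M n) + 1) at_top sequentially"
    by (subst add.commute) (rule filterlim_tendsto_add_at_top[OF tendsto_const])
  have z: "(\<lambda>n. u / real (M n)) \<longlonglongrightarrow> 0" "(\<lambda>n. u / (real (M n) + 1)) \<longlonglongrightarrow> 0"
    by (intro tendsto_divide_0[OF tendsto_const] filterlim_at_top_imp_at_infinity M' M1')+
  \<comment> \<open>The factor M / (M + 1) changes the mesh u / M into u / (M + 1) without affecting
    the limit 1.\<close>
  have "(\<lambda>n. 1 - 1 / (real (M n) + 1)) \<longlonglongrightarrow> 1 - 0"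
    by (intro tendsto_diff tendsto_const tendsto_divide_0[OF tendsto_const] filterlim_at_top_imp_at_infinity M1')
  then have "(\<lambda>n. real (N n) * (u / real (M n)) * (1 - 1 / (real (M n) + 1))) \<longlonglongrightarrow> 1 * (1 - 0)"
    by (rule tendsto_mult[OF ratio])
  also have "(\<lambda>n. real (N n) * (u / real (M n)) * (1 - 1 / (real (M n) + 1))) = (\<lambda>n. real (N n) * (u / (real (M n) + 1)))"
  proof
    fix n
    have "1 - 1 / (real (M n) + 1) = real (M n) / (real (M n) + 1)" by (simp add: field_simps)
    then show "real (N n) * (u / real (M n)) * (1 - 1 / (real (M n) + 1)) = real (N n) * (u / (real (M n) + 1))"
      using M(1)[of n] by simp
  qed
  finally have ratio1: "(\<lambda>n. real (N n) * (u / (real (M n) + 1))) \<longlonglongrightarrow> 1" by simp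
  have "(\<lambda>n. \<Sum>d=1..N n. u / real (M n) * arctan_quot (real d * (u / real (M n)))) \<longlonglongrightarrow> integral {0..1} arctan_quot"
    by (rule riemann_sum_decreasing_tendsto[OF cont anti _ z(1) ratio]) (use M u in auto)
  then have up: "(\<lambda>n. \<Sum>d=1..N n. arctan (real d * (u / real (M n))) / real d) \<longlonglongrightarrow> integral {0..1} arctan_quot"
    by (simp only: riem[OF divide_pos_pos[OF u]] M(1) of_nat_0_less_iff)
  have "(\<lambda>n. \<Sum>d=1..N n. u / (real (M n) + 1) * arctan_quot (real d * (u / (real (M n) + 1)))) \<longlonglongrightarrow> integral {0..1} arctan_quot"
    by (rule riemann_sum_decreasing_tendsto[OF cont anti _ z(2) ratio1]) (use M u in \<open>auto intro!: divide_pos_pos add_nonneg_pos\<close>)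
  then have lo: "(\<lambda>n. \<Sum>d=1..N n. arctan (real d * (u / (real (M n) + 1))) / real d) \<longlonglongrightarrow> integral {0..1} arctan_quot"
    by (simp only: riem[OF divide_pos_pos[OF u]] M1pos)
  show ?thesis
  proof (rule tendsto_sandwich[OF _ _ lo up]; intro always_eventually allI sum_mono)
    fix n d :: nat assume "d \<in> {1..N n}"
    then have d: "real d > 0" and Mn: "real (M n) > 0" using M(1)[of n] by auto
    show "arctan (real d * (u / (real (M n) + 1))) / real d \<le> (\<Sum>k. lattice_kernel u (real d) (real (M n) + 1 + real k))"
      by (rule lattice_kernel_tail(2)[OF d Mn u])
    show "(\<Sum>k. lattice_kernel u (real d) (real (M n) + 1 + real k)) \<le> arctan (real d * (u / real (M n))) / real d"
      by (rule lattice_kernel_tail(3)[OF d Mn u])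
  qed
qed

section \<open>Truncated lattice sums and the passage from u to 1/u\<close>

section \<open>The inversion formula\<close>

lemma lattice_row_sums:
  fixes d u :: real
  assumes "d > 0" "u > 0"
  shows "(\<lambda>k. lattice_kernel u d (real (Suc k))) sums
           (pi / (d * (exp (2 * pi * d * u) - 1)) - 1 / (2 * u) * (1 / d\<^sup>2) + pi / 2 * (1 / d))"
proof -
  have "d * u > 0" using assms by simp
  from sums_divide[OF coth_partial_fractions[OF this], of d]
  have "(\<lambda>k. d * u / ((d * u)\<^sup>2 + (real (Suc k))\<^sup>2) / d) sums
      ((pi / (exp (2 * pi * (d * u)) - 1) - 1 / (2 * (d * u)) + pi / 2) / d)" .
  moreover have "d * u / ((d * u)\<^sup>2 + (real (Suc k))\<^sup>2) / d = lattice_kernel u d (real (Suc k))" for k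
    using assms by (simp add: lattice_kernel_def power_mult_distrib)
  moreover have "(pi / (exp (2 * pi * (d * u)) - 1) - 1 / (2 * (d * u)) + pi / 2) / d
      = pi / (d * (exp (2 * pi * d * u) - 1)) - 1 / (2 * u) * (1 / d\<^sup>2) + pi / 2 * (1 / d)"
    using assms by (simp add: add_divide_distrib diff_divide_distrib power2_eq_square mult_ac)
  ultimately show ?thesis by simp
qed

text \<open>Each row is solved for its Lambert term and its kernel sum is split after k = M, into a
  piece of the finite box and a piece of the corner.\<close>

lemma eta_partial_sum:
  fixes u :: real
  assumes "u > 0" "M > 0"
  shows "(\<Sum>d=1..N. pi / (real d * (exp (2 * pi * real d * u) - 1)))
     = 1 / (2 * u) * (\<Sum>d=1..N. 1 / (real d)\<^sup>2) - pi / 2 * harm N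
       + (\<Sum>d=1..N. \<Sum>k=1..M. lattice_kernel u (real d) (real k))
       + (\<Sum>d=1..N. \<Sum>k. lattice_kernel u (real d) (real M + 1 + real k))"
proof -
  have "pi / (real d * (exp (2 * pi * real d * u) - 1)) = 1 / (2 * u) * (1 / (real d)\<^sup>2) - pi / 2 * (1 / real d)
      + (\<Sum>k=1..M. lattice_kernel u (real d) (real k)) + (\<Sum>k. lattice_kernel u (real d) (real M + 1 + real k))"
    if "d \<in> {1..N}" for d
  proof -
    have d: "real d > 0" using that by simp
    note s = lattice_row_sums[OF d assms(1)]
    have "(\<Sum>k. lattice_kernel u (real d) (real (Suc k))) =
        (\<Sum>k. lattice_kernel u (real d) (real (Suc (k + M)))) + (\<Sum>k<M. lattice_kernel u (real d) (real (Suc k)))"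
      by (rule suminf_split_initial_segment[OF sums_summable[OF s]])
    moreover have "(\<Sum>k<M. lattice_kernel u (real d) (real (Suc k))) = (\<Sum>k=1..M. lattice_kernel u (real d) (real k))"
      by (intro sum.reindex_bij_witness[of _ "\<lambda>d. d - 1" Suc]) auto
    moreover have "real (Suc (k + M)) = real M + 1 + real k" for k by simp
    ultimately have "(\<Sum>k. lattice_kernel u (real d) (real (Suc k))) =
        (\<Sum>k. lattice_kernel u (real d) (real M + 1 + real k)) + (\<Sum>k=1..M. lattice_kernel u (real d) (real k))"
      by (simp only:)
    then show ?thesis using sums_unique[OF s] by linarith
  qed
  then have "(\<Sum>d=1..N. pi / (real d * (exp (2 * pi * real d * u) - 1))) =
      (\<Sum>d=1..N. 1 / (2 * u) * (1 / (real d)\<^sup>2) - pi / 2 * (1 / real d)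
      + (\<Sum>k=1..M. lattice_kernel u (real d) (real k)) + (\<Sum>k. lattice_kernel u (real d) (real M + 1 + real k)))"
    by (rule sum.cong[OF refl])
  also have "\<dots> = (\<Sum>d=1..N. 1 / (2 * u) * (1 / (real d)\<^sup>2)) - (\<Sum>d=1..N. pi / 2 * (1 / real d))
      + (\<Sum>d=1..N. \<Sum>k=1..M. lattice_kernel u (real d) (real k))
      + (\<Sum>d=1..N. \<Sum>k. lattice_kernel u (real d) (real M + 1 + real k))"
    by (simp only: sum.distrib sum_subtractf)
  finally show ?thesis
    by (simp only: sum_distrib_left[symmetric] harm_def inverse_eq_divide)
qed

text \<open>Both harmonic numbers are logarithms up to the same Euler constant, which cancels; what
  remains is ln (N / M).\<close>

lemma harm_diff_tendsto:
  fixes M N :: "nat \<Rightarrow> nat"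
  assumes M: "filterlim M at_top sequentially" and N: "filterlim N at_top sequentially"
    and ratio: "(\<lambda>n. real (M n) / real (N n)) \<longlonglongrightarrow> u" and u: "u > 0"
  shows "(\<lambda>n. harm (N n) - harm (M n)) \<longlonglongrightarrow> - ln u"
proof -
  have "(\<lambda>n. (harm (N n) - ln (real (N n))) - (harm (M n) - ln (real (M n))) - ln (real (M n) / real (N n)))
      \<longlonglongrightarrow> euler_mascheroni - euler_mascheroni - ln u"
    by (intro tendsto_diff tendsto_ln ratio filterlim_compose[OF euler_mascheroni_LIMSEQ M]
          filterlim_compose[OF euler_mascheroni_LIMSEQ N]) (use u in auto)
  moreover have "\<forall>\<^sub>F n in sequentially. M n > 0 \<and> N n > 0"
    using filterlim_at_top[THEN iffD1, OF M, rule_format, of 1]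
      filterlim_at_top[THEN iffD1, OF N, rule_format, of 1] by eventually_elim auto
  then have "\<forall>\<^sub>F n in sequentially. (harm (N n) - ln (real (N n))) - (harm (M n) - ln (real (M n))) - ln (real (M n) / real (N n))
      = harm (N n) - harm (M n)"
    by eventually_elim (simp add: ln_div)
  ultimately show ?thesis by (simp add: tendsto_cong)
qed

text \<open>In terms of the Dedekind eta function this says eta(i/u) = sqrt(u) eta(i u).\<close>

lemma eta_sum_inversion:
  fixes u :: real
  assumes u: "u > 0"
  shows "eta_sum u - eta_sum (1 / u) = pi / (12 * u) - pi * u / 12 + ln u / 2"
proof -
  define N where "N = (\<lambda>n. Suc n)"
  \<comment> \<open>Rounding u N up keeps \<open>M n\<close> positive and makes M / N tend to u, as
    both corners and the harmonic numbers require.\<close>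
  define M where "M = (\<lambda>n. nat \<lceil>u * real (Suc n)\<rceil>)"
  define G where "G = integral {0..1} arctan_quot"
  have Npos: "N n > 0" for n by (simp add: N_def)
  have Mpos: "M n > 0" for n using u by (simp add: M_def)
  have Mb: "u * real (N n) \<le> real (M n)" "real (M n) \<le> u * real (N n) + 1" for n
  proof -
    have "u * real (N n) > 0" using u by (simp add: N_def)
    then show "u * real (N n) \<le> real (M n)" "real (M n) \<le> u * real (N n) + 1"
      unfolding M_def N_def by linarith+
  qed
  have N: "filterlim N at_top sequentially" unfolding N_def by (rule filterlim_Suc)
  have "filterlim (\<lambda>n. u * real (N n)) at_top sequentially"
    by (intro filterlim_tendsto_pos_mult_at_top[OF tendsto_const u] filterlim_compose[OF filterlim_real_sequentially N])
  then have "filterlim (\<lambda>n. real (M n)) at_top sequentially"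
    by (rule filterlim_at_top_mono) (use Mb in auto)
  then have M: "filterlim M at_top sequentially"
    by (simp add: filterlim_sequentially_iff_filterlim_real)
  have ratio: "(\<lambda>n. real (M n) / real (N n)) \<longlonglongrightarrow> u"
  proof (rule tendsto_sandwich)
    show "\<forall>\<^sub>F n in sequentially. u \<le> real (M n) / real (N n)"
      using Mb Npos by (intro always_eventually allI) (simp add: field_simps)
    show "\<forall>\<^sub>F n in sequentially. real (M n) / real (N n) \<le> u + 1 / real (N n)"
      using Mb Npos by (intro always_eventually allI) (simp add: field_simps)
    have "(\<lambda>n. u + 1 / real (N n)) \<longlonglongrightarrow> u + 0"
      by (intro tendsto_add tendsto_const tendsto_divide_0[OF tendsto_const] filterlim_at_top_imp_at_infinity
           filterlim_compose[OF filterlim_real_sequentially N])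
    then show "(\<lambda>n. u + 1 / real (N n)) \<longlonglongrightarrow> u" by simp
  qed auto
  have r2: "(\<lambda>n. real (M n) * (1 / u / real (N n))) \<longlonglongrightarrow> 1"
    using tendsto_divide[OF ratio tendsto_const[of u]] u by (simp add: mult.commute)
  have r1: "(\<lambda>n. real (N n) * (u / real (M n))) \<longlonglongrightarrow> 1"
    using tendsto_inverse[OF r2] u by (simp add: field_simps)
  \<comment> \<open>\<open>C1\<close> is the strip d <= N, k > M of the lattice. After the swap of
    arguments, \<open>C2\<close> is the strip k <= M, d > N of the same lattice.\<close>
  define C1 where "C1 = (\<lambda>n. \<Sum>d=1..N n. \<Sum>k. lattice_kernel u (real d) (real (M n) + 1 + real k))"
  define C2 where "C2 = (\<lambda>n. \<Sum>d=1..M n. \<Sum>k. lattice_kernel (1 / u) (real d) (real (N n) + 1 + real k))"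
  have C1: "C1 \<longlonglongrightarrow> G" unfolding C1_def G_def
    by (rule lattice_corner_tendsto[OF u Mpos M r1])
  have C2: "C2 \<longlonglongrightarrow> G" unfolding C2_def G_def
    by (rule lattice_corner_tendsto[OF _ Npos N r2]) (use u in simp)
  define P where "P = (\<lambda>u N. \<Sum>d=1..N. pi / (real d * (exp (2 * pi * real d * u) - 1)))"
  have P: "(\<lambda>n. P v (K n)) \<longlonglongrightarrow> pi * eta_sum v" if "v > 0" "filterlim K at_top sequentially" for v and K :: "nat \<Rightarrow> nat"
  proof -
    have "(\<lambda>d. pi * (1 / (real (Suc d) * (exp (2 * pi * real (Suc d) * v) - 1)))) sums (pi * eta_sum v)"
      unfolding eta_sum_def by (intro sums_mult summable_sums eta_sum_summable that)
    also have "(\<lambda>d. pi * (1 / (real (Suc d) * (exp (2 * pi * real (Suc d) * v) - 1))))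
       = (\<lambda>d. pi / (real (Suc d) * (exp (2 * pi * real (Suc d) * v) - 1)))" by simp
    finally have "P v \<longlonglongrightarrow> pi * eta_sum v"
      unfolding sums_def P_def
      by (rule Lim_transform_eventually) (intro always_eventually allI sum.reindex_bij_witness[of _ "\<lambda>d. d - 1" Suc]; auto)
    then show ?thesis by (rule filterlim_compose[OF _ that(2)])
  qed
  define Z where "Z = (\<lambda>N. \<Sum>d=1..N. 1 / (real d)\<^sup>2)"
  have Z: "(\<lambda>n. Z (K n)) \<longlonglongrightarrow> pi\<^sup>2 / 6" if "filterlim K at_top sequentially" for K :: "nat \<Rightarrow> nat"
  proof -
    have "Z \<longlonglongrightarrow> pi\<^sup>2 / 6" using inverse_squares_sums
      unfolding sums_def Z_def
      by (rule Lim_transform_eventually) (intro always_eventually allI sum.reindex_bij_witness[of _ "\<lambda>d. d - 1" Suc]; auto)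
    then show ?thesis by (rule filterlim_compose[OF _ that])
  qed
  have box: "(\<Sum>d=1..M n. \<Sum>k=1..N n. lattice_kernel (1 / u) (real d) (real k)) = (\<Sum>d=1..N n. \<Sum>k=1..M n. lattice_kernel u (real d) (real k))" for n
    by (subst sum.swap) (simp add: lattice_kernel_swap[OF u])
  have "P u (N n) - P (1 / u) (M n) =
      1 / (2 * u) * Z (N n) - u / 2 * Z (M n) - pi / 2 * (harm (N n) - harm (M n)) + (C1 n - C2 n)" for n
    unfolding P_def eta_partial_sum[OF u Mpos, of "N n" n] eta_partial_sum[OF divide_pos_pos[OF zero_less_one u] Npos, of "M n" n] box
    by (simp add: Z_def C1_def C2_def algebra_simps)
  \<comment> \<open>The box has cancelled. The sums \<open>Z\<close> of inverse squares, with limit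
    pi^2 / 6, give the terms pi / (12 u) and pi u / 12 after division by pi.\<close>
  moreover have "(\<lambda>n. 1 / (2 * u) * Z (N n) - u / 2 * Z (M n) - pi / 2 * (harm (N n) - harm (M n)) + (C1 n - C2 n))
     \<longlonglongrightarrow> 1 / (2 * u) * (pi\<^sup>2 / 6) - u / 2 * (pi\<^sup>2 / 6) - pi / 2 * (- ln u) + (G - G)"
    by (intro tendsto_intros Z N M C1 C2 harm_diff_tendsto[OF M N ratio u])
  moreover have "(\<lambda>n. P u (N n) - P (1 / u) (M n)) \<longlonglongrightarrow> pi * eta_sum u - pi * eta_sum (1 / u)"
    by (intro tendsto_diff P N M) (use u in auto)
  ultimately have "pi * eta_sum u - pi * eta_sum (1 / u) = 1 / (2 * u) * (pi\<^sup>2 / 6) - u / 2 * (pi\<^sup>2 / 6) - pi / 2 * (- ln u) + (G - G)"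
    by (simp add: LIMSEQ_unique)
  also have "\<dots> = pi * (pi / (12 * u) - pi * u / 12 + ln u / 2)"
    using u by (simp add: field_simps power2_eq_square)
  finally have "pi * (eta_sum u - eta_sum (1 / u)) = pi * (pi / (12 * u) - pi * u / 12 + ln u / 2)"
    by (simp only: right_diff_distrib)
  then show ?thesis by (subst (asm) mult_cancel_left) simp
qed

section \<open>Character and twist as dilations of the argument, and the final combination\<close>

section \<open>The twisted series\<close>

text \<open>Replacing x by p x moves the coefficient from index m to index p m; the inserted zero
  terms leave the sum unchanged.\<close>

lemma dilated_sums:
  fixes c :: "nat \<Rightarrow> real"
  assumes "p > 0" and "(\<lambda>n. c n * exp (- 2 * real n * (real p * x))) sums s"
  shows "(\<lambda>n. (if p dvd n then c (n div p) else 0) * exp (- 2 * real n * x)) sums s"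
proof -
  have "strict_mono ((*) p)" using assms(1) by (simp add: strict_mono_def)
  moreover have "n \<in> range ((*) p)" if "p dvd n" for n using that by (auto elim: dvdE)
  ultimately have "(\<lambda>m. (if p dvd p * m then c (p * m div p) else 0) * exp (- 2 * real (p * m) * x)) sums s \<longleftrightarrow> ?thesis"
    by (intro sums_mono_reindex) auto
  with assms show ?thesis by (simp add: mult_ac)
qed

definition sigma_coprime :: "nat \<Rightarrow> nat \<Rightarrow> real" where
  "sigma_coprime p n = (\<Sum>d | 0 < n \<and> d dvd n \<and> coprime d p. 1 / real d)"

lemma prime_coprime_iff: "prime (p::nat) \<Longrightarrow> coprime d p \<longleftrightarrow> \<not> p dvd d"
  using prime_imp_coprime[of p d] by (auto simp: coprime_commute coprime_absorb_left)

text \<open>The divisors of n removed by the coprimality condition are the p e with e a divisor of n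
  / p, and they contribute 1 / (p e) each.\<close>

lemma sigma_coprime_eq:
  assumes p: "prime p"
  shows "sigma_coprime p n = sigma_inv n - (if p dvd n then sigma_inv (n div p) else 0) / real p"
proof -
  define D where "D = (\<lambda>n::nat. {d. 0 < n \<and> d dvd n})"
  have fin: "finite (D n)" for n
    by (rule finite_subset[of _ "{..n}"]) (auto simp: D_def intro: dvd_imp_le)
  have "sigma_inv n = (\<Sum>d\<in>{d\<in>D n. \<not> p dvd d} \<union> {d\<in>D n. p dvd d}. 1 / real d)"
    unfolding sigma_inv_def D_def by (rule sum.cong) auto
  also have "\<dots> = (\<Sum>d\<in>{d\<in>D n. \<not> p dvd d}. 1 / real d) + (\<Sum>d\<in>{d\<in>D n. p dvd d}. 1 / real d)"
    by (rule sum.union_disjoint) (use fin in auto)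
  also have "(\<Sum>d\<in>{d\<in>D n. \<not> p dvd d}. 1 / real d) = sigma_coprime p n"
    unfolding sigma_coprime_def D_def by (rule sum.cong) (auto simp: prime_coprime_iff[OF p])
  also have "(\<Sum>d\<in>{d\<in>D n. p dvd d}. 1 / real d) = (if p dvd n then sigma_inv (n div p) else 0) / real p"
  proof (cases "p dvd n")
    case True
    then obtain m where n: "n = p * m" by (elim dvdE)
    have p0: "p > 0" using p by (rule prime_gt_0_nat)
    have "(\<Sum>d\<in>{d\<in>D n. p dvd d}. 1 / real d) = (\<Sum>d\<in>D m. 1 / real d / real p)"
      by (rule sum.reindex_bij_witness[of _ "\<lambda>d. p * d" "\<lambda>d. d div p"])
        (use p0 in \<open>auto simp: D_def n elim!: dvdE\<close>)
    then show ?thesis using p0 by (simp add: sigma_inv_def D_def n sum_divide_distrib)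
  next
    case False
    then have "(\<Sum>d\<in>{d\<in>D n. p dvd d}. 1 / real d) = 0"
      by (intro sum.neutral) (auto simp: D_def intro: dvd_trans)
    then show ?thesis using False by simp
  qed
  finally show ?thesis by simp
qed

text \<open>A divisor of p m that is coprime to p already divides m.\<close>

lemma sigma_coprime_div:
  assumes p: "prime p" and "p dvd n"
  shows "sigma_coprime p (n div p) = sigma_coprime p n"
proof -
  obtain m where n: "n = p * m" using assms(2) by (elim dvdE)
  have p0: "p > 0" using p by (rule prime_gt_0_nat)
  have "sigma_coprime p m = sigma_coprime p (p * m)"
    unfolding sigma_coprime_def
    by (rule sum.cong) (use p0 in \<open>auto simp: coprime_dvd_mult_right_iff\<close>)
  then show ?thesis using p0 by (simp add: n)
qed

text \<open>The twist is 1 minus p times the indicator of p | n. On multiples of p the divisor sum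
  may be taken at n / p, so that the subtracted part is a dilation.\<close>

lemma lambert_term_eq:
  assumes p: "prime p" and "n > 0"
  shows "lambert_term p x n = of_real
     ((sigma_coprime p n - real p * (if p dvd n then sigma_coprime p (n div p) else 0)) * exp (- 2 * real n * x))"
proof -
  have "(\<Sum>d | d dvd n. principal_dchar p d / of_nat d) = (\<Sum>d | d dvd n \<and> coprime d p. 1 / of_nat d :: complex)"
    using assms(2) by (intro sum.mono_neutral_cong_right) (auto simp: principal_dchar_def)
  also have "\<dots> = of_real (sigma_coprime p n)"
    using assms(2) by (simp add: sigma_coprime_def)
  finally have "lambert_term p x n = twist_coeff p n * of_real (sigma_coprime p n) * of_real (exp (- 2 * real n * x))"
    by (simp only: lambert_term_def)
  then show ?thesis
    by (simp add: twist_coeff_def sigma_coprime_div[OF p] algebra_simps)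
qed

lemma lambert_term_sums:
  fixes x :: real
  assumes p: "prime p" and x: "x > 0"
  shows "(\<lambda>n. lambert_term p x (Suc n)) sums of_real
     (eta_sum (x / pi) - (real p + 1 / real p) * eta_sum (real p * (x / pi)) + eta_sum ((real p)\<^sup>2 * (x / pi)))"
proof -
  have p0: "p > 0" using p by (rule prime_gt_0_nat)
  \<comment> \<open>The sum of the series with only the character; subtracting p F(p x) then
    accounts for the twist.\<close>
  define F where "F = (\<lambda>x. eta_sum (x / pi) - eta_sum (real p * x / pi) / real p)"
  have F: "(\<lambda>n. sigma_coprime p n * exp (- 2 * real n * x)) sums F x" if "x > 0" for x
  proof -
    have "real p * x > 0" using p0 that by simp
    from sums_diff[OF eta_sum_sums[OF that] sums_divide[OF dilated_sums[OF p0 eta_sum_sums[OF this]], of "real p"]]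
    show ?thesis by (simp add: sigma_coprime_eq[OF p] F_def algebra_simps)
  qed
  define t where "t = (\<lambda>n. (sigma_coprime p n - real p * (if p dvd n then sigma_coprime p (n div p) else 0)) * exp (- 2 * real n * x))"
  have "real p * x > 0" using p0 x by simp
  from sums_diff[OF F[OF x] sums_mult[OF dilated_sums[OF p0 F[OF this]], of "real p"]]
  have "t sums (F x - real p * F (real p * x))"
    by (simp add: t_def algebra_simps)
  \<comment> \<open>Dilation acts on series over all naturals, whereas the series wanted starts at
    1.\<close>
  moreover have "t 0 = 0" by (simp add: t_def sigma_coprime_def)
  ultimately have "(\<lambda>n. t (Suc n)) sums (F x - real p * F (real p * x))"
    by (simp add: sums_Suc_iff)
  then have "(\<lambda>n. of_real (t (Suc n)) :: complex) sums of_real (F x - real p * F (real p * x))"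
    by (rule sums_of_real)
  moreover have "F x - real p * F (real p * x) = eta_sum (x / pi) - (real p + 1 / real p) * eta_sum (real p * (x / pi)) + eta_sum ((real p)\<^sup>2 * (x / pi))"
    using p0 by (simp add: F_def field_simps power2_eq_square)
  ultimately show ?thesis
    by (simp only: lambert_term_eq[OF p zero_less_Suc] t_def)
qed

theorem theorem3:
  fixes p :: nat and \<alpha> \<beta> :: real
  assumes "prime p"
    and "\<alpha> > 0" and "\<beta> > 0"
    and "\<alpha> * \<beta> = pi\<^sup>2 / (real p)\<^sup>2"
  shows "summable (\<lambda>n. lambert_term p \<alpha> (Suc n)) \<and>
         summable (\<lambda>n. lambert_term p \<beta> (Suc n)) \<and>
         (\<Sum>n. lambert_term p \<alpha> (Suc n)) - (\<Sum>n. lambert_term p \<beta> (Suc n)) =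
           of_real ((real p - 1)\<^sup>2 / (2 * real p) * ln (pi / (real p * \<alpha>)))"
proof -
  define q where "q = real p"
  have q: "q > 0" using assms(1) by (simp add: q_def prime_gt_0_nat)
  define a where "a = \<alpha> / pi"
  define b where "b = \<beta> / pi"
  have a: "a > 0" using assms by (simp add: a_def)
  have "\<beta> = pi\<^sup>2 / q\<^sup>2 / \<alpha>" using assms by (simp add: q_def field_simps)
  \<comment> \<open>The hypothesis becomes b = 1 / (q^2 a), so b, q b, q^2 b are the reciprocals of
    q^2 a, q a, a.\<close>
  then have b: "b = 1 / (q\<^sup>2 * a)" by (simp add: a_def b_def power2_eq_square)
  define T where "T = (\<lambda>u. eta_sum u - (q + 1 / q) * eta_sum (q * u) + eta_sum (q\<^sup>2 * u))"
  have sA: "(\<lambda>n. lambert_term p \<alpha> (Suc n)) sums of_real (T a)"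
    and sB: "(\<lambda>n. lambert_term p \<beta> (Suc n)) sums of_real (T b)"
    unfolding T_def q_def a_def b_def by (intro lambert_term_sums assms)+
  have T: "T a - T b = (q - 1)\<^sup>2 / (2 * q) * ln (pi / (q * \<alpha>))"
  proof -
    have b': "eta_sum b = eta_sum (1 / (q\<^sup>2 * a))" "eta_sum (q * b) = eta_sum (1 / (q * a))"
      "eta_sum (q\<^sup>2 * b) = eta_sum (1 / a)"
      using q a by (simp_all add: b power2_eq_square)
    have inv: "eta_sum u - eta_sum (1 / u) = pi / (12 * u) - pi * u / 12 + ln u / 2" if "u > 0" for u
      by (rule eta_sum_inversion[OF that])
    \<comment> \<open>The outer terms have equal coefficients, so they can be exchanged to pair each
      argument with its reciprocal.\<close>
    have "T a - T b = (eta_sum a - eta_sum (1 / a)) - (q + 1 / q) * (eta_sum (q * a) - eta_sum (1 / (q * a)))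
        + (eta_sum (q\<^sup>2 * a) - eta_sum (1 / (q\<^sup>2 * a)))"
      unfolding T_def b' by (simp add: algebra_simps)
    also have "\<dots> = (pi / (12 * a) - pi * a / 12 + ln a / 2)
        - (q + 1 / q) * (pi / (12 * (q * a)) - pi * (q * a) / 12 + ln (q * a) / 2)
        + (pi / (12 * (q\<^sup>2 * a)) - pi * (q\<^sup>2 * a) / 12 + ln (q\<^sup>2 * a) / 2)"
      using q a by (simp add: inv)
    \<comment> \<open>In terms of ln (q a) the ln a cancels; the remaining factor is 1 - (q + 1/q) /
      2 = -(q - 1)^2 / (2 q).\<close>
    also have "ln (q\<^sup>2 * a) = 2 * ln (q * a) - ln a"
      using q a by (simp add: ln_mult ln_realpow)
    also have "(pi / (12 * a) - pi * a / 12 + ln a / 2)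
        - (q + 1 / q) * (pi / (12 * (q * a)) - pi * (q * a) / 12 + ln (q * a) / 2)
        + (pi / (12 * (q\<^sup>2 * a)) - pi * (q\<^sup>2 * a) / 12 + (2 * ln (q * a) - ln a) / 2)
      = (q - 1)\<^sup>2 / (2 * q) * (- ln (q * a))"
      using q a by (simp add: field_simps power2_eq_square)
    also have "- ln (q * a) = ln (pi / (q * \<alpha>))"
      using q assms(2) by (simp add: a_def ln_mult ln_div)
    finally show ?thesis .
  qed
  have "(\<Sum>n. lambert_term p \<alpha> (Suc n)) - (\<Sum>n. lambert_term p \<beta> (Suc n)) = of_real (T a - T b)"
    using sA sB by (simp add: sums_iff)
  with sA sB show ?thesis unfolding T by (simp add: sums_iff q_def)
qed

end
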